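(* Let $n\geq 2$. The set $\widetilde{\mathcal{E}_n}\subset\mathbb{D}$ is a starlike domain about $0$ which contains the disk $\left\{w\in\mathbb{D}: |w|<\frac{n-1}{n+1}\right\}$.
   Context: $\mathbb{D}$ is the open unit disk in $\mathbb{C}$. For $w\in\mathbb{D}$ and an integer $n\geq2$, let $B_w(z)=\left(\frac{z-w}{1-\overline{w}z}\right)^n$, a holomorphic self-map of $\mathbb{D}$ that is also a rational map of $\overline{\mathbb{C}}$. Its Denjoy–Wolff point is the point $z_0\in\overline{\mathbb{D}}$ such that $B_w^k(z)\to z_0$ as $k\to\infty$ for every $z\in\mathbb{D}$ (iterates). $B_w$ is called elliptic if $z_0\in\mathbb{D}$ (otherwise $z_0\in\partial\mathbb{D}$). Let \[ S_n=\left\{w\in\mathbb{D}:\arg(w)\in\left[0,\tfrac{2\pi}{n-1}\right)\right\}, \] with the convention $0\in S_n$, and let $\mathcal{E}_n=\{w\in S_n: B_w\text{ is elliptic}\}$. Define $\widetilde{\mathcal{E}_n}=\mathcal{E}_n\cup\bigcup_{j=1}^{n-2}R_j(\mathcal{E}_n)$, where $R_j(z)=e^{2\pi i j/(n-1)}z$. "Domain" means a non-empty connected open subset of $\mathbb{C}$; starlike about $0$ means that $w$ in the set implies $tw$ in the set for all $t\in[0,1]$. *)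

theory Defs
  imports "HOL-Analysis.Analysis"
begin

definition blaschke_pow :: "nat \<Rightarrow> complex \<Rightarrow> complex \<Rightarrow> complex" where
  "blaschke_pow n w z = ((z - w) / (1 - cnj w * z)) ^ n"

text \<open>Denjoy--Wolff point of a self-map of the open unit disk, as the common limit of all
  orbits starting in the disk; the point is unique whenever it exists.\<close>

definition is_Denjoy_Wolff_point :: "(complex \<Rightarrow> complex) \<Rightarrow> complex \<Rightarrow> bool" where
  "is_Denjoy_Wolff_point f z0 \<longleftrightarrow>
     z0 \<in> cball 0 1 \<and> (\<forall>z\<in>ball 0 1. (\<lambda>k. (f ^^ k) z) \<longlonglongrightarrow> z0)"

definition elliptic :: "(complex \<Rightarrow> complex) \<Rightarrow> bool" where
  "elliptic f \<longleftrightarrow> (\<exists>z0. is_Denjoy_Wolff_point f z0 \<and> z0 \<in> ball 0 1)"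

text \<open>\<^const>\<open>Arg2pi\<close> takes values in $[0, 2\pi)$ and \<^prop>\<open>Arg2pi 0 = 0\<close>, so 0 belongs to the sector.\<close>

definition sector :: "nat \<Rightarrow> complex set" where
  "sector n = {w \<in> ball 0 1. Arg2pi w \<in> {0..<2 * pi / (real n - 1)}}"

definition elliptic_params :: "nat \<Rightarrow> complex set" where
  "elliptic_params n = {w \<in> sector n. elliptic (blaschke_pow n w)}"

definition sector_rotation :: "nat \<Rightarrow> nat \<Rightarrow> complex \<Rightarrow> complex" where
  "sector_rotation n j z = exp (2 * of_real pi * \<i> * of_nat j / (of_nat n - 1)) * z"

definition elliptic_params_full :: "nat \<Rightarrow> complex set" where
  "elliptic_params_full n =
     elliptic_params n \<union> (\<Union>j\<in>{1..n - 2}. sector_rotation n j ` elliptic_params n)"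

definition is_domain :: "complex set \<Rightarrow> bool" where
  "is_domain S \<longleftrightarrow> S \<noteq> {} \<and> open S \<and> connected S"

definition starlike_about_0 :: "complex set \<Rightarrow> bool" where
  "starlike_about_0 S \<longleftrightarrow> (\<forall>w\<in>S. \<forall>t\<in>{0..1::real}. of_real t * w \<in> S)"

end

theory Submission
  imports Defs "HOL-Library.Real_Mod"
begin

text \<open>
  Write \<open>B\<close> for \<open>blaschke_pow n w\<close> and \<open>M\<close> for the disk automorphism whose \<open>n\<close>-th power is \<open>B\<close>.
  The elliptic parameters are described through their complement: \<open>B\<close> fails to be elliptic exactly if
  it has a fixed point \<open>\<zeta>\<close> on the unit circle that is not repelling, that is, whose multiplier
  \<open>n (1 - \<bar>w\<bar>\<^sup>2) / \<bar>\<zeta> - w\<bar>\<^sup>2\<close> is at most 1 (\<open>elliptic_iff\<close>).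

  One direction rests on the function \<open>julia_quotient p z = (1 - \<bar>z\<bar>\<^sup>2) / \<bar>1 - cnj p * z\<bar>\<^sup>2\<close>. The
  automorphism \<open>M\<close> multiplies it by a constant, and the \<open>n\<close>-th power reduces it by less than a constant
  factor, by a strict Cauchy--Schwarz inequality for geometric sums. The two constants balance in such a
  way that it strictly increases along orbits of \<open>B\<close> outside \<open>p\<close>, both for a fixed point \<open>p\<close> in
  the open disk and for a nonrepelling fixed point \<open>p\<close> on the circle (\<open>julia_quotient_blaschke_pow\<close>). In the first case it is a Lyapunov function that forces every orbit
  to converge to \<open>p\<close>; in the second case it excludes a fixed point in the open disk. Conversely, if there
  is no fixed point in the open disk, then fixed points of \<open>r * B\<close>, which exist by Brouwer's theorem,
  accumulate for \<open>r \<rightarrow> 1\<close> at a nonrepelling fixed point on the circle.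

  The description by boundary fixed points gives the theorem. The full set is the set of all elliptic
  parameters in the disk, because rotating \<open>w\<close> by an \<open>(n-1)\<close>-th root of unity conjugates \<open>B\<close> by the same
  rotation. The set is open, since its complement in the disk is a projection along the compact circle of
  a closed set. It contains the disk of radius \<open>(n-1)/(n+1)\<close>, since there
  \<open>\<bar>\<zeta> - w\<bar>\<^sup>2 \<le> (1 + \<bar>w\<bar>)\<^sup>2 < n (1 - \<bar>w\<bar>\<^sup>2)\<close>.

  For starlikeness, non-ellipticity has to persist when \<open>w = \<rho> cis a\<close> moves outward along its ray
  (\<open>nonrepelling_outward\<close>). Lift the circle map: \<open>cis (a + y)\<close> is fixed iff a real function \<open>h\<close> of \<open>y\<close> takes a
  value in \<open>2\<pi>\<int>\<close> there, and the fixed point is nonrepelling iff \<open>h' y \<le> 0\<close>. On \<open>[0,\<pi>]\<close> the sign of \<open>h'\<close>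
  changes at most once, from positive to negative; the value \<open>h \<pi>\<close> does not depend on \<open>\<rho>\<close>, and no value
  of \<open>h\<close> decreases as \<open>\<rho>\<close> grows. So a value attained where \<open>h' \<le> 0\<close> is still attained at
  such a point for every larger \<open>\<rho>\<close>.
\<close>

section \<open>A strict Cauchy--Schwarz inequality for geometric sums\<close>

text \<open>Equality would make the vectors \<open>(c\<^sup>j)\<close> and \<open>(v\<^sup>j)\<close>, \<open>j < n\<close>, proportional; both begin with 1, so
  they would be equal, and the entries at \<open>j = 1\<close> would give \<open>c = v\<close>.\<close>

lemma geometric_Cauchy_Schwarz_strict:
  fixes c v :: complex
  assumes "n \<ge> 2" and "c \<noteq> v"
  shows "(norm (\<Sum>j<n. (cnj c * v) ^ j))\<^sup>2
           < (\<Sum>j<n. norm c ^ (2 * j)) * (\<Sum>j<n. norm v ^ (2 * j))"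
proof -
  define C where "C = (\<Sum>j<n. norm c ^ (2 * j))"
  define V where "V = (\<Sum>j<n. norm v ^ (2 * j))"
  define S where "S = (\<Sum>j<n. (cnj c * v) ^ j)"
  have "C \<ge> (\<Sum>j\<in>{0}. norm c ^ (2 * j))"
    unfolding C_def using assms(1) by (intro sum_mono2) auto
  then have C: "C > 0" by simp
  have sq: "of_real (norm x ^ (2 * j)) = x ^ j * cnj x ^ j" for x :: complex and j
  proof -
    have "of_real (norm x ^ (2 * j)) = (complex_of_real ((norm x)\<^sup>2)) ^ j" by (simp add: power_mult)
    then show ?thesis by (simp only: complex_norm_square power_mult_distrib)
  qed
  have Cc: "of_real C = (\<Sum>j<n. c ^ j * cnj c ^ j)" and Vc: "of_real V = (\<Sum>j<n. v ^ j * cnj v ^ j)"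
    by (simp_all only: C_def V_def of_real_sum sq)
  have S1: "S = (\<Sum>j<n. cnj c ^ j * v ^ j)" and S2: "cnj S = (\<Sum>j<n. c ^ j * cnj v ^ j)"
    by (simp_all add: S_def power_mult_distrib)
  \<comment> \<open>\<open>D\<close> is \<open>C\<^sup>2\<close> times the squared distance from \<open>(v\<^sup>j)\<close> to the line spanned by \<open>(c\<^sup>j)\<close>.\<close>
  define D where "D = (\<Sum>j<n. (norm (of_real C * v ^ j - S * c ^ j))\<^sup>2)"
  have "complex_of_real D = (\<Sum>j<n. (of_real C * v ^ j - S * c ^ j) * (of_real C * cnj v ^ j - cnj S * cnj c ^ j))"
    by (simp add: D_def complex_norm_square del: of_real_power)
  also have "\<dots> = (\<Sum>j<n. of_real C * of_real C * (v ^ j * cnj v ^ j) - of_real C * cnj S * (cnj c ^ j * v ^ j)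
                   - of_real C * S * (c ^ j * cnj v ^ j) + S * cnj S * (c ^ j * cnj c ^ j))"
    by (intro sum.cong) (auto simp: algebra_simps)
  also have "\<dots> = of_real C * of_real C * of_real V - of_real C * cnj S * S
                   - of_real C * S * cnj S + S * cnj S * of_real C"
    by (simp add: sum.distrib sum_subtractf del: cnj_sum
        flip: Cc Vc S1 S2 sum_distrib_left)
  also have "\<dots> = of_real (C * (C * V - (norm S)\<^sup>2))"
    by (simp add: complex_norm_square algebra_simps del: of_real_power)
  finally have D: "D = C * (C * V - (norm S)\<^sup>2)"
    using of_real_eq_iff by blast
  have "D > 0"
  proof (rule ccontr)
    assume "\<not> D > 0"
    moreover have "D \<ge> 0" unfolding D_def by (intro sum_nonneg) auto
    ultimately have "D = 0" by simp
    then have z: "of_real C * v ^ j - S * c ^ j = 0" if "j < n" for j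
      using that by (simp add: D_def sum_nonneg_eq_0_iff)
    have "S = of_real C" using z[of 0] assms(1) by simp
    then have "of_real C * (v - c) = 0" using z[of 1] assms(1) by (simp add: algebra_simps)
    then show False using C assms(2) by simp
  qed
  then show ?thesis
    using C unfolding D C_def[symmetric] V_def[symmetric] S_def[symmetric]
    by (simp add: zero_less_mult_iff)
qed

section \<open>The disk automorphism\<close>

definition disk_moebius :: "complex \<Rightarrow> complex \<Rightarrow> complex" where
  "disk_moebius w z = (z - w) / (1 - cnj w * z)"

lemma blaschke_pow_eq: "blaschke_pow n w z = disk_moebius w z ^ n"
  by (simp add: blaschke_pow_def disk_moebius_def)

lemma denominator_nonzero:
  assumes "norm w < 1" "norm z \<le> 1"
  shows "1 - cnj w * z \<noteq> 0"
proof
  assume "1 - cnj w * z = 0"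
  then have "norm (cnj w * z) = 1" by (metis eq_iff_diff_eq_0 norm_one)
  moreover have "norm (cnj w * z) \<le> norm w"
    using assms by (simp add: norm_mult mult_left_le)
  ultimately show False using assms by simp
qed

lemma one_minus_cnj_disk_moebius:
  assumes "norm w < 1" "norm p \<le> 1" "norm z \<le> 1"
  shows "1 - cnj (disk_moebius w p) * disk_moebius w z
           = of_real (1 - (norm w)\<^sup>2) * (1 - cnj p * z) / (cnj (1 - cnj w * p) * (1 - cnj w * z))"
proof -
  have "1 - cnj w * z \<noteq> 0" "cnj (1 - cnj w * p) \<noteq> 0"
    using denominator_nonzero[OF assms(1,3)] denominator_nonzero[OF assms(1,2)]
    by (simp_all only: complex_cnj_zero_iff not_False_eq_True)
  then show ?thesis
    by (simp add: disk_moebius_def divide_simps complex_norm_square del: of_real_power)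
       (simp add: algebra_simps)
qed

lemma one_minus_norm_disk_moebius:
  assumes "norm w < 1" "norm z \<le> 1"
  shows "1 - (norm (disk_moebius w z))\<^sup>2
           = (1 - (norm w)\<^sup>2) * (1 - (norm z)\<^sup>2) / (norm (1 - cnj w * z))\<^sup>2"
proof -
  have "complex_of_real (1 - (norm (disk_moebius w z))\<^sup>2)
          = of_real ((1 - (norm w)\<^sup>2) * (1 - (norm z)\<^sup>2) / (norm (1 - cnj w * z))\<^sup>2)"
    using one_minus_cnj_disk_moebius[OF assms(1,2,2)]
    by (simp add: complex_norm_square mult.commute del: of_real_power)
  then show ?thesis using of_real_eq_iff by blast
qed

lemma norm_disk_moebius_less:
  assumes "norm w < 1" "norm z < 1"
  shows "norm (disk_moebius w z) < 1"
proof -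
  have "0 < 1 - (norm (disk_moebius w z))\<^sup>2"
    using assms denominator_nonzero[of w z]
    by (simp add: one_minus_norm_disk_moebius abs_square_less_1)
  then show ?thesis by (simp add: abs_square_less_1)
qed

lemma norm_disk_moebius_eq_1:
  assumes "norm w < 1" "norm z = 1"
  shows "norm (disk_moebius w z) = 1"
proof -
  have "(norm (disk_moebius w z))\<^sup>2 = 1\<^sup>2"
    using one_minus_norm_disk_moebius[of w z] assms by simp
  then show ?thesis by (simp only: power2_eq_iff_nonneg norm_ge_zero zero_le_one)
qed

lemma norm_disk_moebius_le:
  assumes "norm w < 1" "norm z \<le> 1"
  shows "norm (disk_moebius w z) \<le> 1"
  using norm_disk_moebius_less[of w z] norm_disk_moebius_eq_1[of w z] assms by fastforce

lemma disk_moebius_inject: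
  assumes "norm w < 1" "norm p \<le> 1" "norm z \<le> 1" "disk_moebius w p = disk_moebius w z"
  shows "p = z"
proof -
  have "(p - w) * (1 - cnj w * z) = (z - w) * (1 - cnj w * p)"
    using assms(4) denominator_nonzero[OF assms(1,2)] denominator_nonzero[OF assms(1,3)]
    by (simp add: disk_moebius_def frac_eq_eq)
  then have "(p - z) * (1 - w * cnj w) = 0" by (simp add: algebra_simps)
  moreover have "1 - w * cnj w \<noteq> 0"
    using denominator_nonzero[of w w] assms(1) by (simp add: mult.commute)
  ultimately show ?thesis by simp
qed

section \<open>The power of the automorphism\<close>

lemma norm_blaschke_pow_le:
  assumes "norm w < 1" "norm z \<le> 1"
  shows "norm (blaschke_pow n w z) \<le> 1"
  using norm_disk_moebius_le[OF assms] by (simp add: blaschke_pow_eq norm_power power_le_one)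

lemma norm_blaschke_pow_less:
  assumes "norm w < 1" "norm z < 1" "n \<ge> 2"
  shows "norm (blaschke_pow n w z) < 1"
  using norm_disk_moebius_less[OF assms(1,2)] assms(3)
  by (simp add: blaschke_pow_eq norm_power power_less_one_iff)

lemma continuous_on_blaschke_pow:
  assumes "norm w < 1"
  shows "continuous_on (cball 0 1) (blaschke_pow n w)"
  unfolding blaschke_pow_def [abs_def]
  using denominator_nonzero[OF assms] by (intro continuous_intros) auto

section \<open>The Julia quotient increases along orbits\<close>

text \<open>For \<open>\<bar>p\<bar> = 1\<close> this is the Poisson kernel, and its superlevel sets are the horodisks at \<open>p\<close>. For
  \<open>\<bar>p\<bar> < 1\<close> it is a multiple of \<open>1 - d\<^sup>2\<close>, where \<open>d\<close> is the pseudohyperbolic distance of \<open>z\<close> from \<open>p\<close>. The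
  common formula treats the Schwarz--Pick lemma and Julia's lemma at once.\<close>

definition julia_quotient :: "complex \<Rightarrow> complex \<Rightarrow> real" where
  "julia_quotient p z = (1 - (norm z)\<^sup>2) / (norm (1 - cnj p * z))\<^sup>2"

lemma julia_quotient_disk_moebius:
  assumes "norm w < 1" "norm p \<le> 1" "norm z < 1"
  shows "julia_quotient (disk_moebius w p) (disk_moebius w z)
           = (norm (1 - cnj w * p))\<^sup>2 / (1 - (norm w)\<^sup>2) * julia_quotient p z"
proof -
  have nz: "norm (1 - cnj w * z) \<noteq> 0" "norm (1 - cnj w * p) \<noteq> 0" "norm (1 - cnj z * p) \<noteq> 0"
    using denominator_nonzero[of w z] denominator_nonzero[of w p] denominator_nonzero[of z p] assms
    by auto
  have c: "norm (1 - cnj p * z) = norm (1 - cnj z * p)"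
    by (metis complex_cnj_cnj complex_cnj_diff complex_cnj_mult complex_cnj_one complex_mod_cnj mult.commute)
  have w: "1 - (norm w)\<^sup>2 > 0" using assms by (simp add: abs_square_less_1)
  have "norm (1 - cnj (disk_moebius w p) * disk_moebius w z)
     = (1 - (norm w)\<^sup>2) * norm (1 - cnj p * z) / (norm (1 - cnj w * p) * norm (1 - cnj w * z))"
    using assms w
    by (simp only: one_minus_cnj_disk_moebius less_imp_le norm_mult norm_divide norm_of_real complex_mod_cnj abs_of_pos)
  then show ?thesis
    using nz w assms unfolding julia_quotient_def c
    by (simp add: one_minus_norm_disk_moebius power_mult_distrib power_divide)
       (simp add: divide_simps power2_eq_square)
qed

text \<open>Both the numerator \<open>1 - \<bar>v\<^sup>n\<bar>\<^sup>2\<close> and the denominator \<open>1 - cnj c\<^sup>n * v\<^sup>n\<close> are their first-power analogues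
  times a geometric sum, so the claim is the strict Cauchy--Schwarz inequality for these sums.\<close>

lemma julia_quotient_power:
  assumes "n \<ge> 2" "c \<noteq> v" "norm c \<le> 1" "norm v < 1"
  shows "julia_quotient c v < (\<Sum>j<n. norm c ^ (2 * j)) * julia_quotient (c ^ n) (v ^ n)"
proof -
  define C where "C = (\<Sum>j<n. norm c ^ (2 * j))"
  define V where "V = (\<Sum>j<n. norm v ^ (2 * j))"
  define S where "S = norm (\<Sum>j<n. (cnj c * v) ^ j)"
  have cv: "norm (cnj c * v) < 1"
    using assms mult_left_le_one_le[of "norm v" "norm c"] by (simp add: norm_mult)
  have "1 - (cnj c * v) ^ n = (1 - cnj c * v) * (\<Sum>j<n. (cnj c * v) ^ j)"
    by (rule one_diff_power_eq)
  then have den: "norm (1 - cnj (c ^ n) * v ^ n) = norm (1 - cnj c * v) * S"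
    by (simp add: S_def power_mult_distrib flip: norm_mult)
  have "norm ((cnj c * v) ^ n) < 1"
    using cv assms(1) by (simp add: norm_power power_less_one_iff)
  then have "1 - (cnj c * v) ^ n \<noteq> 0" by auto
  then have nz: "norm (1 - cnj c * v) > 0" "S > 0"
    using den by (auto simp: power_mult_distrib S_def)
  have num: "1 - (norm (v ^ n))\<^sup>2 = (1 - (norm v)\<^sup>2) * V"
    using one_diff_power_eq[of "(norm v)\<^sup>2" n]
    by (simp add: V_def norm_power power_mult[symmetric] mult.commute)
  have v: "1 - (norm v)\<^sup>2 > 0" using assms by (simp add: abs_square_less_1)
  have CS: "S\<^sup>2 < C * V"
    unfolding S_def C_def V_def by (rule geometric_Cauchy_Schwarz_strict) fact+
  have "julia_quotient c v = julia_quotient c v * 1" by simp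
  also have "\<dots> < julia_quotient c v * (C * V / S\<^sup>2)"
    using CS nz v by (intro mult_strict_left_mono) (auto simp: julia_quotient_def)
  also have "\<dots> = C * julia_quotient (c ^ n) (v ^ n)"
    unfolding julia_quotient_def den num using nz by (simp add: power_mult_distrib)
  finally show ?thesis by (simp add: C_def)
qed

text \<open>The hypothesis \<open>mult\<close> says that the factor gained under the automorphism compensates the factor lost
  under the power. It holds with equality at a fixed point in the open disk; at a fixed point on the circle
  the sum is \<open>n\<close> and the hypothesis says that the multiplier is at most 1.\<close>

lemma julia_quotient_blaschke_pow:
  assumes "n \<ge> 2" "norm w < 1" "norm p \<le> 1" "norm z < 1" "z \<noteq> p"
    and fixed: "blaschke_pow n w p = p"
    and mult: "(\<Sum>j<n. norm (disk_moebius w p) ^ (2 * j)) * (1 - (norm w)\<^sup>2) \<le> (norm (1 - cnj w * p))\<^sup>2"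
  shows "julia_quotient p z < julia_quotient p (blaschke_pow n w z)"
proof -
  define C where "C = (\<Sum>j<n. norm (disk_moebius w p) ^ (2 * j))"
  have "C \<ge> (\<Sum>j\<in>{0}. norm (disk_moebius w p) ^ (2 * j))"
    unfolding C_def using assms(1) by (intro sum_mono2) auto
  then have C: "C > 0" by simp
  have w: "1 - (norm w)\<^sup>2 > 0" using assms by (simp add: abs_square_less_1)
  have pos: "julia_quotient p z > 0"
  proof -
    have "1 - cnj z * p \<noteq> 0" using denominator_nonzero assms by blast
    then have "1 - cnj p * z \<noteq> 0"
      by (metis complex_cnj_cnj complex_cnj_diff complex_cnj_mult complex_cnj_one complex_cnj_zero mult.commute)
    then show ?thesis
      using assms by (simp add: julia_quotient_def abs_square_less_1)
  qed
  have "C * julia_quotient p z \<le> (norm (1 - cnj w * p))\<^sup>2 / (1 - (norm w)\<^sup>2) * julia_quotient p z"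
    using mult w pos by (intro mult_right_mono) (auto simp: C_def field_simps)
  also have "\<dots> = julia_quotient (disk_moebius w p) (disk_moebius w z)"
    using assms by (simp add: julia_quotient_disk_moebius)
  also have "\<dots> < C * julia_quotient p (blaschke_pow n w z)"
    using julia_quotient_power[of n "disk_moebius w p" "disk_moebius w z"] assms
      disk_moebius_inject[of w p z] norm_disk_moebius_le[of w p] norm_disk_moebius_less[of w z]
    by (auto simp: C_def blaschke_pow_eq)
  finally show ?thesis using C by simp
qed

section \<open>Ellipticity and fixed points in the open disk\<close>

text \<open>A limit \<open>q\<close> of a subsequence of the orbit satisfies \<open>V (f q) = V q\<close>, because both equal the limit
  of the monotone sequence of values of \<open>V\<close> along the orbit; hence \<open>q = p\<close>.\<close>

lemma converges_of_strict_Lyapunov: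
  fixes f :: "'a::metric_space \<Rightarrow> 'a" and V :: "'a \<Rightarrow> real"
  assumes K: "compact K" "f ` K \<subseteq> K" and f: "continuous_on K f" and V: "continuous_on K V"
    and incr: "\<And>z. z \<in> K \<Longrightarrow> z \<noteq> p \<Longrightarrow> V z < V (f z)" and fp: "f p = p" and x: "x \<in> K"
  shows "(\<lambda>k. (f ^^ k) x) \<longlonglongrightarrow> p"
proof (rule ccontr)
  define X where "X k = (f ^^ k) x" for k
  assume "\<not> (\<lambda>k. (f ^^ k) x) \<longlonglongrightarrow> p"
  then have "\<not> X \<longlonglongrightarrow> p" by (simp add: X_def[abs_def])
  then obtain e where e: "e > 0" "\<And>N. \<exists>k\<ge>N. dist (X k) p \<ge> e"
    by (auto simp: lim_sequentially not_less)
  then have "infinite {k. dist (X k) p \<ge> e}"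
    by (auto simp: infinite_nat_iff_unbounded_le)
  then obtain r :: "nat \<Rightarrow> nat" where r: "strict_mono r" "\<And>k. dist (X (r k)) p \<ge> e"
    using infinite_enumerate by blast
  have XK: "X k \<in> K" for k
    using K(2) x by (induction k) (auto simp: X_def)
  then obtain q s where q: "q \<in> K" "strict_mono s" "((X \<circ> r) \<circ> s) \<longlonglongrightarrow> q"
    using K(1) unfolding compact_def by (metis comp_apply)
  define t where "t = r \<circ> s"
  have t: "strict_mono t" "(\<lambda>k. X (t k)) \<longlonglongrightarrow> q"
    using r(1) q strict_mono_o by (auto simp: t_def o_def)
  have "dist q p \<ge> e"
    using r(2) by (intro tendsto_lowerbound[OF tendsto_dist[OF t(2) tendsto_const]]) (auto simp: t_def)
  then have "q \<noteq> p" using e by auto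
  have mono: "incseq (\<lambda>k. V (X k))"
  proof (rule incseq_SucI)
    fix k
    show "V (X k) \<le> V (X (Suc k))"
      using incr[OF XK[of k]] fp by (cases "X k = p") (auto simp: X_def)
  qed
  obtain b where "\<And>z. z \<in> K \<Longrightarrow> V z \<le> b"
    using compact_continuous_image[OF V K(1)] by (metis bounded_real compact_imp_bounded image_eqI abs_le_D1)
  then obtain L where L: "(\<lambda>k. V (X k)) \<longlonglongrightarrow> L"
    using incseq_convergent[OF mono] XK by metis
  have V1: "(\<lambda>k. V (X (t k))) \<longlonglongrightarrow> V q"
    using continuous_on_tendsto_compose[OF V t(2)] q XK by simp
  have "(\<lambda>k. f (X (t k))) \<longlonglongrightarrow> f q"
    using continuous_on_tendsto_compose[OF f t(2)] q XK by simp
  then have V2: "(\<lambda>k. V (X (Suc (t k)))) \<longlonglongrightarrow> V (f q)"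
  proof (intro continuous_on_tendsto_compose[OF V])
    show "f q \<in> K" using q K(2) by auto
    show "\<forall>\<^sub>F k in sequentially. X (Suc (t k)) \<in> K" using XK by (intro always_eventually) blast
  qed (simp add: X_def)
  have "V q = L"
    using LIMSEQ_subseq_LIMSEQ[OF L t(1)] V1 by (auto simp: o_def intro: LIMSEQ_unique)
  moreover have "V (f q) = L"
    using LIMSEQ_subseq_LIMSEQ[OF LIMSEQ_Suc[OF L] t(1)] V2 by (auto simp: o_def intro: LIMSEQ_unique)
  ultimately show False using incr[OF q(1) \<open>q \<noteq> p\<close>] by simp
qed


text \<open>The Julia quotient at the fixed point is a strict Lyapunov function. It vanishes on the circle, so its
  superlevel sets at positive levels are compact subsets of the open disk.\<close>

lemma elliptic_if_interior_fixed_point: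
  assumes n: "n \<ge> 2" and w: "norm w < 1" and p: "norm p < 1" and fixed: "blaschke_pow n w p = p"
  shows "elliptic (blaschke_pow n w)"
proof -
  let ?B = "blaschke_pow n w"
  define c where "c = disk_moebius w p"
  have p2: "1 - (norm p)\<^sup>2 > 0" using p by (simp add: abs_square_less_1)
  have D: "(norm (1 - cnj w * p))\<^sup>2 > 0" using denominator_nonzero[OF w, of p] p by simp
  have norm_p: "norm p = norm c ^ n"
    using arg_cong[OF fixed, of norm] by (simp add: blaschke_pow_eq norm_power c_def)
  have "(1 - (norm c)\<^sup>2) * (\<Sum>j<n. norm c ^ (2 * j)) = 1 - (norm p)\<^sup>2"
    using one_diff_power_eq[of "(norm c)\<^sup>2" n]
    unfolding norm_p by (simp add: power_mult[symmetric] mult.commute)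
  \<comment> \<open>The gain under the automorphism is exactly the loss under the power.\<close>
  then have "(1 - (norm w)\<^sup>2) * (\<Sum>j<n. norm c ^ (2 * j)) = (norm (1 - cnj w * p))\<^sup>2"
    using p2 D w p by (simp add: c_def one_minus_norm_disk_moebius divide_simps)
  then have incr: "julia_quotient p z < julia_quotient p (?B z)" if "norm z < 1" "z \<noteq> p" for z
    using that n w p fixed
    by (intro julia_quotient_blaschke_pow) (auto simp: c_def mult.commute)
  have cont: "continuous_on (cball 0 1) (julia_quotient p)"
    unfolding julia_quotient_def[abs_def] using denominator_nonzero[OF p]
    by (intro continuous_intros) auto
  have "(\<lambda>k. (?B ^^ k) x) \<longlonglongrightarrow> p" if x: "norm x < 1" for x
  proof -
    define K where "K = cball 0 1 \<inter> julia_quotient p -` {julia_quotient p x..}"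
    have "julia_quotient p x > 0"
      using denominator_nonzero[OF p, of x] x by (simp add: julia_quotient_def abs_square_less_1)
    then have K1: "norm z < 1" if "z \<in> K" for z
      using that by (cases "norm z = 1") (auto simp: K_def julia_quotient_def)
    have "closed K"
      unfolding K_def by (intro continuous_closed_preimage cont) auto
    then have K: "compact K"
      unfolding K_def by (metis bounded_Int bounded_cball compact_eq_bounded_closed)
    have sub: "K \<subseteq> cball 0 1" by (auto simp: K_def)
    have "?B z \<in> K" if "z \<in> K" for z
    proof (cases "z = p")
      case False
      then show ?thesis
        using incr[OF K1[OF that]] norm_blaschke_pow_le[OF w, of z n] that by (auto simp: K_def)
    qed (use that fixed in simp)
    then show ?thesis
      using K1 incr fixed x
      by (intro converges_of_strict_Lyapunov[OF K _ continuous_on_subset[OF continuous_on_blaschke_pow[OF w] sub]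
            continuous_on_subset[OF cont sub]]) (auto simp: K_def)
  qed
  then show ?thesis
    using p unfolding elliptic_def is_Denjoy_Wolff_point_def by (intro exI[of _ p]) auto
qed

lemma interior_fixed_point_if_elliptic:
  assumes n: "n \<ge> 2" and w: "norm w < 1" and "elliptic (blaschke_pow n w)"
  obtains p where "norm p < 1" "blaschke_pow n w p = p"
proof -
  let ?B = "blaschke_pow n w"
  obtain p where p: "norm p < 1" and lim: "(\<lambda>k. (?B ^^ k) 0) \<longlonglongrightarrow> p"
    using assms(3) by (auto simp: elliptic_def is_Denjoy_Wolff_point_def)
  have orbit: "norm ((?B ^^ k) 0) < 1" for k
    by (induction k) (simp_all add: norm_blaschke_pow_less[OF w _ n])
  have "(\<lambda>k. ?B ((?B ^^ k) 0)) \<longlonglongrightarrow> ?B p"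
    using continuous_on_tendsto_compose[OF continuous_on_blaschke_pow[OF w] lim] p orbit
    by (simp add: less_imp_le)
  moreover have "(\<lambda>k. ?B ((?B ^^ k) 0)) \<longlonglongrightarrow> p"
    using LIMSEQ_Suc[OF lim] by simp
  ultimately show ?thesis using that p LIMSEQ_unique by blast
qed

section \<open>Non-ellipticity and nonrepelling fixed points on the circle\<close>

text \<open>The inequality says that the derivative of \<^term>\<open>blaschke_pow n w\<close> at the fixed point, which is the
  positive number \<open>n (1 - \<bar>w\<bar>\<^sup>2) / \<bar>\<zeta> - w\<bar>\<^sup>2\<close>, is at most 1.\<close>

definition nonrepelling_boundary_fixed_point :: "nat \<Rightarrow> complex \<Rightarrow> complex \<Rightarrow> bool" where
  "nonrepelling_boundary_fixed_point n w \<zeta> \<longleftrightarrow>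
     norm \<zeta> = 1 \<and> blaschke_pow n w \<zeta> = \<zeta> \<and> real n * (1 - (norm w)\<^sup>2) \<le> (norm (\<zeta> - w))\<^sup>2"

lemma norm_denominator_on_circle:
  assumes "norm w < 1" "norm \<zeta> = 1"
  shows "norm (1 - cnj w * \<zeta>) = norm (\<zeta> - w)"
  using norm_disk_moebius_eq_1[OF assms] denominator_nonzero[of w \<zeta>] assms
  by (auto simp: disk_moebius_def norm_divide divide_simps split: if_splits)

text \<open>The Julia quotient at \<open>\<zeta>\<close> strictly increases under the map and so cannot agree at a point and its
  image.\<close>

lemma no_interior_fixed_point_if_nonrepelling:
  assumes n: "n \<ge> 2" and w: "norm w < 1" and \<zeta>: "nonrepelling_boundary_fixed_point n w \<zeta>"
    and p: "norm p < 1"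
  shows "blaschke_pow n w p \<noteq> p"
proof
  assume "blaschke_pow n w p = p"
  moreover have "julia_quotient \<zeta> p < julia_quotient \<zeta> (blaschke_pow n w p)"
    using \<zeta> n w p norm_disk_moebius_eq_1[of w \<zeta>]
    by (intro julia_quotient_blaschke_pow)
       (auto simp: nonrepelling_boundary_fixed_point_def norm_denominator_on_circle)
  ultimately show False by simp
qed

text \<open>A fixed point \<open>z\<close> of \<open>r * B\<close> with \<open>r < 1\<close> satisfies \<open>\<bar>B z\<bar> \<ge> \<bar>z\<bar>\<close>, so \<open>(1 - \<bar>B z\<bar>\<^sup>2) / (1 - \<bar>z\<bar>\<^sup>2)\<close> is at
  most 1. This quotient has an explicit form that is continuous up to the circle, where it is the multiplier;
  the bound therefore passes to a limit of such fixed points as \<open>r \<rightarrow> 1\<close>. Such a limit is a fixed point of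
  \<open>B\<close> in the closed disk, hence on the circle.\<close>

lemma nonrepelling_if_no_interior_fixed_point:
  assumes n: "n \<ge> 2" and w: "norm w < 1" and nofix: "\<And>p. norm p < 1 \<Longrightarrow> blaschke_pow n w p \<noteq> p"
  obtains \<zeta> where "nonrepelling_boundary_fixed_point n w \<zeta>"
proof -
  let ?B = "blaschke_pow n w" and ?M = "disk_moebius w"
  define r where "r k = real (Suc k) / real (Suc (Suc k))" for k
  have r: "0 < r k" "r k < 1" for k by (auto simp: r_def)
  have "\<exists>z\<in>cball 0 1. of_real (r k) * ?B z = z" for k
  proof -
    have "norm (of_real (r k) * ?B z) \<le> 1" if "norm z \<le> 1" for z
      using r[of k] norm_blaschke_pow_le[OF w that, of n] by (simp add: norm_mult mult_le_one)
    then have "(\<lambda>z. of_real (r k) * ?B z) \<in> cball 0 1 \<rightarrow> cball 0 1" by auto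
    moreover have "continuous_on (cball 0 1) (\<lambda>z. of_real (r k) * ?B z)"
      using w by (intro continuous_intros continuous_on_blaschke_pow)
    ultimately obtain z where "z \<in> cball 0 1" "of_real (r k) * ?B z = z"
      using brouwer[OF compact_cball[of 0 1] convex_cball] by force
    then show ?thesis by blast
  qed
  then obtain z where z: "\<And>k. norm (z k) \<le> 1" "\<And>k. of_real (r k) * ?B (z k) = z k"
    by (simp add: Bex_def) metis
  have less: "norm (z k) < 1" for k
  proof -
    have "norm (z k) = r k * norm (?B (z k))"
      using arg_cong[OF z(2)[of k], of norm] r[of k] by (simp add: norm_mult)
    also have "\<dots> \<le> r k" using norm_blaschke_pow_le[OF w z(1)[of k], of n] r[of k] by (simp add: mult_left_le)
    finally show ?thesis using r[of k] by simp
  qed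
  have ineq: "(1 - (norm w)\<^sup>2) * (\<Sum>j<n. norm (?M (z k)) ^ (2 * j)) \<le> (norm (1 - cnj w * z k))\<^sup>2" for k
  proof -
    define m where "m = norm (?M (z k))"
    have "norm (z k) = r k * norm (?B (z k))"
      using arg_cong[OF z(2)[of k], of norm] r[of k] by (simp add: norm_mult)
    then have "norm (z k) \<le> norm (?B (z k))"
      using r[of k] by (simp add: mult_left_le_one_le)
    then have "(norm (z k))\<^sup>2 \<le> (m ^ n)\<^sup>2"
      by (simp add: blaschke_pow_eq norm_power m_def power_mono)
    then have "(1 - m\<^sup>2) * (\<Sum>j<n. m ^ (2 * j)) \<le> 1 - (norm (z k))\<^sup>2"
      using one_diff_power_eq[of "m\<^sup>2" n] by (simp add: power_mult[symmetric] mult.commute)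
    moreover have "1 - m\<^sup>2 = (1 - (norm w)\<^sup>2) * (1 - (norm (z k))\<^sup>2) / (norm (1 - cnj w * z k))\<^sup>2"
      using one_minus_norm_disk_moebius[OF w z(1)] by (simp add: m_def)
    moreover have "1 - (norm (z k))\<^sup>2 > 0" using less[of k] by (simp add: abs_square_less_1)
    moreover have "(norm (1 - cnj w * z k))\<^sup>2 > 0" using denominator_nonzero[OF w z(1)] by simp
    ultimately have "(1 - (norm (z k))\<^sup>2) * ((1 - (norm w)\<^sup>2) * (\<Sum>j<n. m ^ (2 * j)))
                       \<le> (1 - (norm (z k))\<^sup>2) * (norm (1 - cnj w * z k))\<^sup>2"
      by (simp add: divide_simps mult_ac)
    then show ?thesis
      using \<open>1 - (norm (z k))\<^sup>2 > 0\<close> unfolding m_def by (simp only: mult_le_cancel_left_pos)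
  qed
  obtain \<zeta> s where \<zeta>: "norm \<zeta> \<le> 1" "strict_mono s" "(z \<circ> s) \<longlonglongrightarrow> \<zeta>"
    using compact_cball[of "0::complex" 1] z(1) unfolding compact_def by (metis mem_cball_0)
  then have lim: "(\<lambda>k. z (s k)) \<longlonglongrightarrow> \<zeta>" by (simp add: o_def)
  have "r \<longlonglongrightarrow> 1" unfolding r_def[abs_def] by (rule LIMSEQ_Suc[OF LIMSEQ_n_over_Suc_n])
  then have rs: "(\<lambda>k. r (s k)) \<longlonglongrightarrow> 1" using LIMSEQ_subseq_LIMSEQ \<zeta>(2) by (force simp: o_def)
  have "(\<lambda>k. ?B (z (s k))) \<longlonglongrightarrow> ?B \<zeta>"
    using continuous_on_tendsto_compose[OF continuous_on_blaschke_pow[OF w] lim] \<zeta> z(1) by simp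
  then have "(\<lambda>k. of_real (r (s k)) * ?B (z (s k))) \<longlonglongrightarrow> of_real 1 * ?B \<zeta>"
    by (intro tendsto_intros rs)
  then have fixed: "?B \<zeta> = \<zeta>" using lim LIMSEQ_unique unfolding z(2) by auto
  then have norm1: "norm \<zeta> = 1" using nofix \<zeta>(1) by force
  have nz: "1 - cnj w * \<zeta> \<noteq> 0" using denominator_nonzero w \<zeta>(1) by blast
  have "(\<lambda>k. ?M (z (s k))) \<longlonglongrightarrow> ?M \<zeta>"
    unfolding disk_moebius_def by (intro tendsto_intros lim nz)
  then have "(\<lambda>k. (1 - (norm w)\<^sup>2) * (\<Sum>j<n. norm (?M (z (s k))) ^ (2 * j)))
               \<longlonglongrightarrow> (1 - (norm w)\<^sup>2) * (\<Sum>j<n. norm (?M \<zeta>) ^ (2 * j))"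
    by (intro tendsto_intros)
  moreover have "(\<lambda>k. (norm (1 - cnj w * z (s k)))\<^sup>2) \<longlonglongrightarrow> (norm (1 - cnj w * \<zeta>))\<^sup>2"
    by (intro tendsto_intros lim)
  ultimately have "(1 - (norm w)\<^sup>2) * (\<Sum>j<n. norm (?M \<zeta>) ^ (2 * j)) \<le> (norm (1 - cnj w * \<zeta>))\<^sup>2"
    using ineq by (intro LIMSEQ_le) auto
  then have "nonrepelling_boundary_fixed_point n w \<zeta>"
    using fixed norm1 norm_disk_moebius_eq_1[OF w norm1]
    unfolding norm_denominator_on_circle[OF w norm1]
    by (simp add: nonrepelling_boundary_fixed_point_def mult.commute)
  then show ?thesis using that by blast
qed

lemma elliptic_iff:
  assumes "n \<ge> 2" "norm w < 1"
  shows "elliptic (blaschke_pow n w) \<longleftrightarrow> (\<nexists>\<zeta>. nonrepelling_boundary_fixed_point n w \<zeta>)"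
  using assms elliptic_if_interior_fixed_point interior_fixed_point_if_elliptic
    no_interior_fixed_point_if_nonrepelling nonrepelling_if_no_interior_fixed_point
  by metis

text \<open>After clearing denominators, the pairs of a parameter and a nonrepelling fixed point form a
  relatively closed set, and projecting along the compact circle preserves closedness.\<close>

lemma open_no_nonrepelling:
  "open {w \<in> ball 0 1. \<nexists>\<zeta>. nonrepelling_boundary_fixed_point n w \<zeta>}"
proof -
  define G where "G = {x \<in> sphere (0::complex) 1 \<times> ball (0::complex) 1.
       (fst x - snd x) ^ n - fst x * (1 - cnj (snd x) * fst x) ^ n = 0 \<and>
       real n * (1 - (norm (snd x))\<^sup>2) - (norm (fst x - snd x))\<^sup>2 \<le> 0}"
  have iff: "nonrepelling_boundary_fixed_point n w \<zeta> \<longleftrightarrow> (\<zeta>, w) \<in> G" if "norm w < 1" for w \<zeta>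
    using that denominator_nonzero[of w \<zeta>]
    by (auto simp: G_def nonrepelling_boundary_fixed_point_def blaschke_pow_def power_divide divide_simps)
  have "closedin (top_of_set (sphere 0 1 \<times> ball 0 1)) G"
  proof -
    have "G = (sphere 0 1 \<times> ball 0 1) \<inter> ((\<lambda>x. (fst x - snd x) ^ n - fst x * (1 - cnj (snd x) * fst x) ^ n) -` {0}
       \<inter> (\<lambda>x. real n * (1 - (norm (snd x))\<^sup>2) - (norm (fst x - snd x))\<^sup>2) -` {..0})"
      by (auto simp: G_def)
    moreover have "closed ((\<lambda>x::complex\<times>complex. (fst x - snd x) ^ n - fst x * (1 - cnj (snd x) * fst x) ^ n) -` {0}
       \<inter> (\<lambda>x::complex\<times>complex. real n * (1 - (norm (snd x))\<^sup>2) - (norm (fst x - snd x))\<^sup>2) -` {..0})"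
      by (intro closed_Int closed_vimage continuous_intros)
    ultimately show ?thesis by (auto simp: closedin_closed)
  qed
  then have "closedin (top_of_set (ball 0 1)) {w. \<exists>\<zeta>. \<zeta> \<in> sphere 0 1 \<and> (\<zeta>, w) \<in> G}"
    by (intro closedin_compact_projection) auto
  then have "openin (top_of_set (ball 0 1)) (ball 0 1 - {w. \<exists>\<zeta>. \<zeta> \<in> sphere 0 1 \<and> (\<zeta>, w) \<in> G})"
    by (simp add: openin_diff)
  moreover have "ball 0 1 - {w. \<exists>\<zeta>. \<zeta> \<in> sphere 0 1 \<and> (\<zeta>, w) \<in> G}
      = {w \<in> ball 0 1. \<nexists>\<zeta>. nonrepelling_boundary_fixed_point n w \<zeta>}"
    using iff by (auto simp: G_def)
  ultimately show ?thesis by (metis openin_open_trans open_ball)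
qed


section \<open>Non-ellipticity persists outward along rays\<close>

text \<open>With \<open>w = \<rho> cis a\<close>, the image of \<open>cis (a + y)\<close> has angle \<open>a + y\<close> plus this displacement. The
  arctangent is the argument of \<open>1 - \<rho> cis (- y)\<close>, a point of the right half plane, so the formula is smooth in \<open>y\<close>.\<close>

definition circle_lift :: "nat \<Rightarrow> real \<Rightarrow> real \<Rightarrow> real \<Rightarrow> real" where
  "circle_lift n a \<rho> y = (real n - 1) * (a + y) + 2 * real n * arctan (\<rho> * sin y / (1 - \<rho> * cos y))"

lemma one_minus_mult_cos_pos:
  assumes "0 \<le> \<rho>" "\<rho> < 1"
  shows "1 - \<rho> * cos y > (0::real)"
  using mult_left_le[of "cos y" \<rho>] assms by (simp add: algebra_simps)

lemma blaschke_pow_polar: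
  assumes "0 \<le> \<rho>" "\<rho> < 1"
  shows "blaschke_pow n (of_real \<rho> * cis a) (cis (a + y)) = cis (a + y + circle_lift n a \<rho> y)"
proof -
  define q where "q = 1 - \<rho> * cos y"
  define s where "s = \<rho> * sin y"
  define A where "A = arctan (s / q)"
  define R where "R = q * sqrt (1 + (s / q)\<^sup>2)"
  have q: "q > 0" unfolding q_def by (rule one_minus_mult_cos_pos[OF assms])
  have "sqrt (1 + (s / q)\<^sup>2) > 0" by (simp add: add_pos_nonneg)
  then have "Complex q s = of_real R * cis A" and R: "R \<noteq> 0"
    using q by (simp_all add: complex_eq_iff R_def A_def cos_arctan sin_arctan)
  moreover from this have "Complex q (- s) = of_real R * cis (- A)"
    by (metis cis_cnj complex_cnj complex_cnj_complex_of_real complex_cnj_mult)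
  ultimately have quot: "Complex q s / Complex q (- s) = cis (2 * A)"
    by (simp add: cis_divide)
  have num: "cis (a + y) - of_real \<rho> * cis a = cis (a + y) * Complex q s"
  proof -
    have "Complex q s = 1 - of_real \<rho> * cis (- y)"
      by (simp add: complex_eq_iff q_def s_def)
    then show ?thesis by (simp only:) (simp add: algebra_simps cis_mult)
  qed
  have den: "1 - cnj (of_real \<rho> * cis a) * cis (a + y) = Complex q (- s)"
    by (simp add: cis_cnj mult.assoc cis_mult) (simp add: complex_eq_iff q_def s_def)
  have "disk_moebius (of_real \<rho> * cis a) (cis (a + y)) = cis (a + y) * cis (2 * A)"
    unfolding disk_moebius_def num den by (simp flip: quot)
  then have "blaschke_pow n (of_real \<rho> * cis a) (cis (a + y)) = cis (real n * (a + y + 2 * A))"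
    by (simp only: blaschke_pow_eq cis_mult Complex.DeMoivre)
  also have "real n * (a + y + 2 * A) = a + y + circle_lift n a \<rho> y"
    by (simp add: circle_lift_def A_def s_def q_def algebra_simps)
  finally show ?thesis .
qed

lemma nonrepelling_polar_iff:
  assumes "0 \<le> \<rho>" "\<rho> < 1"
  shows "nonrepelling_boundary_fixed_point n (of_real \<rho> * cis a) (cis (a + y)) \<longleftrightarrow>
     (\<exists>k::int. circle_lift n a \<rho> y = of_int k * (2 * pi)) \<and> real n * (1 - \<rho>\<^sup>2) \<le> 1 - 2 * \<rho> * cos y + \<rho>\<^sup>2"
proof -
  have "norm (cis (a + y) - of_real \<rho> * cis a) = norm (cis a * (cis y - of_real \<rho>))"
    by (simp add: algebra_simps cis_mult)
  also have "\<dots>\<^sup>2 = (cos y - \<rho>)\<^sup>2 + (sin y)\<^sup>2"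
    by (simp add: norm_mult cmod_power2)
  also have "\<dots> = 1 - 2 * \<rho> * cos y + \<rho>\<^sup>2"
    using sin_cos_squared_add[of y] by (simp add: power2_diff)
  finally have dist: "(norm (cis (a + y) - of_real \<rho> * cis a))\<^sup>2 = 1 - 2 * \<rho> * cos y + \<rho>\<^sup>2" .
  have "blaschke_pow n (of_real \<rho> * cis a) (cis (a + y)) = cis (a + y)
          \<longleftrightarrow> cis (circle_lift n a \<rho> y) = 1"
    unfolding blaschke_pow_polar[OF assms] by (simp flip: cis_mult)
  then show ?thesis
    using assms by (simp add: nonrepelling_boundary_fixed_point_def dist cis_eq_1_iff norm_mult)
qed

lemma circle_lift_has_derivative:
  assumes "0 \<le> \<rho>" "\<rho> < 1"
  shows "(circle_lift n a \<rho> has_real_derivative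
           (real n * (1 - \<rho>\<^sup>2) / (1 - 2 * \<rho> * cos y + \<rho>\<^sup>2) - 1)) (at y)"
proof -
  define q where "q = 1 - \<rho> * cos y"
  have q: "q > 0" unfolding q_def by (rule one_minus_mult_cos_pos[OF assms])
  have D: "q\<^sup>2 + (\<rho> * sin y)\<^sup>2 = 1 - 2 * \<rho> * cos y + \<rho>\<^sup>2"
    using sin_cos_squared_add[of y] unfolding q_def by algebra
  have pos: "q\<^sup>2 + (\<rho> * sin y)\<^sup>2 > 0" using q by (simp add: add_pos_nonneg)
  have num: "\<rho> * cos y * q - \<rho> * sin y * (\<rho> * sin y) = \<rho> * cos y - \<rho>\<^sup>2"
    using sin_cos_squared_add[of y] unfolding q_def by algebra
  have "(circle_lift n a \<rho> has_real_derivative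
      (real n - 1) + 2 * real n * (inverse (1 + (\<rho> * sin y / q)\<^sup>2)
        * ((\<rho> * cos y * q - \<rho> * sin y * (\<rho> * sin y)) / (q * q)))) (at y)"
    unfolding circle_lift_def [abs_def] using q unfolding q_def
    by (auto intro!: derivative_eq_intros)
  also have "inverse (1 + (\<rho> * sin y / q)\<^sup>2) * ((\<rho> * cos y * q - \<rho> * sin y * (\<rho> * sin y)) / (q * q))
      = (\<rho> * cos y - \<rho>\<^sup>2) / (q\<^sup>2 + (\<rho> * sin y)\<^sup>2)"
    unfolding num using q by (simp add: power_divide divide_simps power2_eq_square)
  also have "(real n - 1) + 2 * real n * ((\<rho> * cos y - \<rho>\<^sup>2) / (q\<^sup>2 + (\<rho> * sin y)\<^sup>2))
      = real n * (1 - \<rho>\<^sup>2) / (1 - 2 * \<rho> * cos y + \<rho>\<^sup>2) - 1"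
    using pos unfolding D by (simp add: divide_simps) (simp add: algebra_simps)
  finally show ?thesis .
qed

lemma circle_lift_mono_radius:
  assumes "0 \<le> \<rho>" "\<rho> \<le> \<rho>'" "\<rho>' < 1" "0 \<le> y" "y \<le> pi"
  shows "circle_lift n a \<rho> y \<le> circle_lift n a \<rho>' y"
proof -
  have "\<rho> * sin y / (1 - \<rho> * cos y) \<le> \<rho>' * sin y / (1 - \<rho>' * cos y)"
  proof -
    have "\<rho> * sin y \<le> \<rho>' * sin y"
      using assms sin_ge_zero by (intro mult_right_mono) auto
    then show ?thesis
      using one_minus_mult_cos_pos[of \<rho> y] one_minus_mult_cos_pos[of \<rho>' y] assms
      by (simp add: divide_simps) (simp add: algebra_simps)
  qed
  then have "arctan (\<rho> * sin y / (1 - \<rho> * cos y)) \<le> arctan (\<rho>' * sin y / (1 - \<rho>' * cos y))"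
    by (rule arctan_monotone')
  then show ?thesis
    by (simp add: circle_lift_def mult_left_mono)
qed

text \<open>By the intermediate value theorem, the value that the lift takes at \<open>y\<close> for the radius \<open>\<rho>\<close> is taken
  again for \<open>\<rho>'\<close> between \<open>y\<close> and \<open>\<pi>\<close>. To find a point where, moreover, the lift does not increase, the search
  starts at \<open>y\<close> or, if the lift still increases there, at its maximum.\<close>

lemma nonrepelling_outward_upper:
  assumes \<rho>: "0 \<le> \<rho>" "\<rho> \<le> \<rho>'" "\<rho>' < 1" and y: "0 \<le> y" "y \<le> pi"
    and nonrep: "nonrepelling_boundary_fixed_point n (of_real \<rho> * cis a) (cis (a + y))"
  shows "\<exists>\<zeta>. nonrepelling_boundary_fixed_point n (of_real \<rho>' * cis a) \<zeta>"
proof -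
  \<comment> \<open>\<open>d\<close> has the sign opposite to the derivative of the lift, and it increases in \<open>x\<close> on \<open>[0,\<pi>]\<close>.\<close>
  define d where "d r x = 1 - 2 * r * cos x + r\<^sup>2 - real n * (1 - r\<^sup>2)" for r x
  have d_mono: "d r x \<le> d r x'" if "0 \<le> r" "0 \<le> x" "x \<le> x'" "x' \<le> pi" for r x x'
    using that by (auto simp: d_def intro!: mult_left_mono cos_monotone_0_pi_le)
  have deriv: "\<exists>D. (circle_lift n a r has_real_derivative D) (at x) \<and> (0 \<le> D \<longleftrightarrow> d r x \<le> 0) \<and> (D \<le> 0 \<longleftrightarrow> d r x \<ge> 0)"
    if "0 \<le> r" "r < 1" for r x
  proof -
    have "(1 - r)\<^sup>2 > 0" using that by simp
    also have "(1 - r)\<^sup>2 \<le> 1 - 2 * r * cos x + r\<^sup>2"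
      using mult_left_le[of "cos x" r] that by (simp add: power2_diff)
    finally show ?thesis
      by (intro exI[of _ "real n * (1 - r\<^sup>2) / (1 - 2 * r * cos x + r\<^sup>2) - 1"] conjI
            circle_lift_has_derivative that) (auto simp: d_def divide_simps)
  qed
  have cont: "continuous_on S (circle_lift n a \<rho>')" for S
    using deriv[of \<rho>'] \<rho> by (meson DERIV_isCont continuous_at_imp_continuous_on order_trans)
  have cont_d: "continuous_on S (d \<rho>')" for S
    unfolding d_def[abs_def] by (intro continuous_intros)
  obtain k :: int where k: "circle_lift n a \<rho> y = of_int k * (2 * pi)" and dy: "d \<rho> y \<ge> 0"
    using nonrep \<rho> by (auto simp: nonrepelling_polar_iff d_def)
  define c where "c = of_int k * (2 * pi)"
  \<comment> \<open>At \<open>\<pi>\<close> the sine vanishes, so the lift does not depend on the radius.\<close>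
  have "circle_lift n a \<rho>' pi = circle_lift n a \<rho> pi" by (simp add: circle_lift_def)
  also have "\<dots> \<le> circle_lift n a \<rho> y"
    using \<rho> y dy d_mono[of \<rho> y] deriv[of \<rho>]
    by (intro DERIV_nonpos_imp_nonincreasing[OF y(2)]) (meson order_trans le_less_trans)
  finally have at_pi: "circle_lift n a \<rho>' pi \<le> c" by (simp add: k c_def)
  have at_y: "c \<le> circle_lift n a \<rho>' y"
    using circle_lift_mono_radius[OF \<rho> y, of n a] by (simp add: k c_def)
  have d_pi: "d \<rho>' pi \<ge> 0"
  proof -
    have "0 \<le> d \<rho> pi" using d_mono[of \<rho> y pi] \<rho> y dy by simp
    moreover have "d \<rho> pi \<le> d \<rho>' pi"
    proof -
      have "\<rho>\<^sup>2 \<le> \<rho>'\<^sup>2" using \<rho> by (intro power_mono) auto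
      then have "real n * \<rho>\<^sup>2 \<le> real n * \<rho>'\<^sup>2" by (intro mult_left_mono) auto
      with \<open>\<rho>\<^sup>2 \<le> \<rho>'\<^sup>2\<close> show ?thesis
        using \<rho>(2) by (simp only: d_def right_diff_distrib cos_pi)
    qed
    ultimately show ?thesis by simp
  qed
  obtain y0 where y0: "y \<le> y0" "y0 \<le> pi" "d \<rho>' y0 \<ge> 0" "c \<le> circle_lift n a \<rho>' y0"
  proof (cases "d \<rho>' y \<ge> 0")
    case True
    then show ?thesis using that y at_y by blast
  next
    case False
    then obtain y0 where y0: "y \<le> y0" "y0 \<le> pi" "d \<rho>' y0 = 0"
      using IVT'[of "d \<rho>'" y 0 pi] d_pi y cont_d by auto
    have "circle_lift n a \<rho>' y \<le> circle_lift n a \<rho>' y0"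
    proof (rule DERIV_nonneg_imp_nondecreasing[OF y0(1)])
      fix x assume x: "y \<le> x" "x \<le> y0"
      then have "d \<rho>' x \<le> 0" using d_mono[of \<rho>' x y0] y0 y \<rho> by simp
      then show "\<exists>D. (circle_lift n a \<rho>' has_real_derivative D) (at x) \<and> 0 \<le> D"
        using deriv[of \<rho>' x] \<rho> by auto
    qed
    then show ?thesis using that[of y0] y0 at_y by simp
  qed
  obtain y' where y': "y0 \<le> y'" "y' \<le> pi" "circle_lift n a \<rho>' y' = c"
    using IVT2'[of "circle_lift n a \<rho>'" pi c y0] at_pi y0 cont by auto
  have "d \<rho>' y' \<ge> 0"
    using d_mono[of \<rho>' y0 y'] y0 y' y \<rho> by simp
  then have "nonrepelling_boundary_fixed_point n (of_real \<rho>' * cis a) (cis (a + y'))"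
    using y' \<rho> by (auto simp: nonrepelling_polar_iff d_def c_def)
  then show ?thesis by blast
qed

lemma nonrepelling_cnj:
  assumes "nonrepelling_boundary_fixed_point n w \<zeta>"
  shows "nonrepelling_boundary_fixed_point n (cnj w) (cnj \<zeta>)"
proof -
  have "blaschke_pow n (cnj w) (cnj \<zeta>) = cnj (blaschke_pow n w \<zeta>)"
    by (simp add: blaschke_pow_def)
  moreover have "norm (cnj \<zeta> - cnj w) = norm (\<zeta> - w)"
    by (metis complex_cnj_diff complex_mod_cnj)
  ultimately show ?thesis
    using assms by (simp add: nonrepelling_boundary_fixed_point_def)
qed

text \<open>A fixed point on the other half of the circle, as seen from the ray through \<open>w\<close>, is brought to the
  half where \<open>0 \<le> y \<le> \<pi>\<close> by complex conjugation.\<close>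

lemma nonrepelling_outward:
  assumes t: "0 \<le> t" "t \<le> 1" and w: "norm w < 1"
    and nonrep: "nonrepelling_boundary_fixed_point n (of_real t * w) \<zeta>"
  shows "\<exists>\<zeta>. nonrepelling_boundary_fixed_point n w \<zeta>"
proof -
  obtain a where a: "w = of_real (norm w) * cis a"
    by (metis rcis_cmod_Arg rcis_def)
  define \<rho> where "\<rho> = t * norm w"
  have tw: "of_real t * w = of_real \<rho> * cis a"
    by (subst a) (simp add: \<rho>_def)
  have \<rho>: "0 \<le> \<rho>" "\<rho> \<le> norm w" using t by (auto simp: \<rho>_def mult_left_le_one_le)
  define y where "y = Arg (\<zeta> / cis a)"
  have y: "- pi < y" "y \<le> pi" by (simp_all add: y_def mpi_less_Arg Arg_le_pi)
  have "norm (\<zeta> / cis a) = 1"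
    using nonrep by (simp add: nonrepelling_boundary_fixed_point_def norm_divide)
  then have "cis y = \<zeta> / cis a"
    using rcis_cmod_Arg[of "\<zeta> / cis a"] by (simp add: y_def rcis_def)
  then have \<zeta>: "\<zeta> = cis (a + y)" by (simp flip: cis_mult)
  show ?thesis
  proof (cases "0 \<le> y")
    case True
    then show ?thesis
      using nonrepelling_outward_upper[OF \<rho> w True y(2)] nonrep a unfolding tw \<zeta> by metis
  next
    case False
    have cnj_polar: "cnj (of_real r * cis a) = of_real r * cis (- a)" for r
      by (simp add: cis_cnj)
    have "nonrepelling_boundary_fixed_point n (of_real \<rho> * cis (- a)) (cis (- a + - y))"
      using nonrepelling_cnj[OF nonrep] unfolding tw \<zeta> cnj_polar cis_cnj by simp
    then obtain \<zeta>' where "nonrepelling_boundary_fixed_point n (of_real (norm w) * cis (- a)) \<zeta>'"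
      using nonrepelling_outward_upper[OF \<rho> w, of "- y"] False y by auto
    then have "nonrepelling_boundary_fixed_point n (cnj w) \<zeta>'"
      using a cnj_polar by metis
    from nonrepelling_cnj[OF this] show ?thesis by auto
  qed
qed

section \<open>Rotational symmetry\<close>

text \<open>Since \<open>\<omega>\<^sup>n = \<omega>\<close>, rotation by \<open>\<omega>\<close> conjugates the map with parameter \<open>w\<close> to the one with parameter
  \<open>\<omega> w\<close>.\<close>

lemma nonrepelling_rotate:
  assumes \<omega>: "norm \<omega> = 1" "\<omega> ^ (n - 1) = 1" and n: "n \<ge> 1"
    and nonrep: "nonrepelling_boundary_fixed_point n w \<zeta>"
  shows "nonrepelling_boundary_fixed_point n (\<omega> * w) (\<omega> * \<zeta>)"
proof -
  have c: "cnj \<omega> * \<omega> = 1"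
    using \<omega>(1) complex_norm_square[of \<omega>] by (simp add: mult.commute)
  have "\<omega> ^ n = \<omega>" using \<omega>(2) n by (metis power_minus_mult mult_1 zero_less_one less_le_trans)
  have "disk_moebius (\<omega> * w) (\<omega> * \<zeta>) = \<omega> * (\<zeta> - w) / (1 - (cnj \<omega> * \<omega>) * (cnj w * \<zeta>))"
    by (simp add: disk_moebius_def algebra_simps)
  then have "disk_moebius (\<omega> * w) (\<omega> * \<zeta>) = \<omega> * disk_moebius w \<zeta>"
    by (simp add: c disk_moebius_def)
  then have "blaschke_pow n (\<omega> * w) (\<omega> * \<zeta>) = \<omega> * blaschke_pow n w \<zeta>"
    by (simp add: blaschke_pow_eq power_mult_distrib \<open>\<omega> ^ n = \<omega>\<close>)
  moreover have "norm (\<omega> * \<zeta> - \<omega> * w) = norm (\<zeta> - w)"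
    using \<omega>(1) by (metis mult_1 norm_mult right_diff_distrib)
  ultimately show ?thesis
    using nonrep \<omega>(1) by (simp add: nonrepelling_boundary_fixed_point_def norm_mult)
qed

lemma sector_rotation_eq:
  assumes "n \<ge> 2"
  shows "sector_rotation n j z = cis (real j * (2 * pi / (real n - 1))) * z"
proof -
  have "2 * of_real pi * \<i> * of_nat j / (of_nat n - 1) = \<i> * complex_of_real (real j * (2 * pi / (real n - 1)))"
    by simp
  then show ?thesis unfolding sector_rotation_def cis_conv_exp by presburger
qed

lemma elliptic_rotate_iff:
  assumes n: "n \<ge> 2" and w: "norm w < 1"
  shows "elliptic (blaschke_pow n (sector_rotation n j w)) \<longleftrightarrow> elliptic (blaschke_pow n w)"
proof -
  define \<theta> where "\<theta> = real j * (2 * pi / (real n - 1))"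
  have e: "real (n - 1) * \<theta> = real j * (2 * pi)"
    using n by (simp add: \<theta>_def of_nat_diff)
  have p1: "cis \<theta> ^ (n - 1) = 1"
    unfolding Complex.DeMoivre e cis_eq_1_iff by (intro exI[of _ "int j"]) simp
  have p2: "cis (- \<theta>) ^ (n - 1) = 1"
    unfolding Complex.DeMoivre mult_minus_right e cis_eq_1_iff by (intro exI[of _ "- int j"]) simp
  have inv: "cis (- \<theta>) * (cis \<theta> * x) = x" for x by (simp add: cis_mult flip: mult.assoc)
  have "(\<exists>\<zeta>. nonrepelling_boundary_fixed_point n (cis \<theta> * w) \<zeta>)
          \<longleftrightarrow> (\<exists>\<zeta>. nonrepelling_boundary_fixed_point n w \<zeta>)"
    using nonrepelling_rotate[of "cis \<theta>" n w] nonrepelling_rotate[of "cis (- \<theta>)" n "cis \<theta> * w"] p1 p2 n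
    unfolding inv by (metis norm_cis one_le_numeral order_trans)
  then show ?thesis
    using n w by (simp add: elliptic_iff norm_mult sector_rotation_eq \<theta>_def)
qed

lemma sector_rotation_cover:
  assumes n: "n \<ge> 2" and w: "norm w < 1"
  obtains j v where "j \<le> n - 2" "v \<in> sector n" "w = sector_rotation n j v"
proof -
  define \<beta> where "\<beta> = 2 * pi / (real n - 1)"
  have \<beta>: "\<beta> > 0" "(real n - 1) * \<beta> = 2 * pi" using n by (simp_all add: \<beta>_def)
  define m where "m = \<lfloor>Arg2pi w / \<beta>\<rfloor>"
  define j where "j = nat m"
  define b where "b = Arg2pi w - real j * \<beta>"
  have m0: "m \<ge> 0" using Arg2pi_ge_0[of w] \<beta> by (simp add: m_def)
  have "real_of_int m \<le> Arg2pi w / \<beta>" "Arg2pi w / \<beta> < real_of_int m + 1"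
    by (simp_all add: m_def)
  then have b: "0 \<le> b" "b < \<beta>"
    using \<beta> m0 by (simp_all add: b_def j_def field_simps)
  have "real j * \<beta> < (real n - 1) * \<beta>"
    using b(1) Arg2pi_lt_2pi[of w] \<beta> by (simp add: b_def)
  then have "real j < real n - 1" using \<beta>(1) by (simp only: mult_less_cancel_right_pos)
  then have "j \<le> n - 2" by linarith
  moreover define v where "v = of_real (norm w) * cis b"
  have "Arg2pi v = b \<or> v = 0"
  proof (cases "w = 0")
    case False
    have "\<beta> \<le> 2 * pi" using \<beta> n by (simp add: \<beta>_def divide_simps)
    then have "Arg2pi v = b"
      using False b by (intro Arg2pi_unique[of "norm w"]) (auto simp: v_def cis_conv_exp)
    then show ?thesis ..
  qed (simp add: v_def)
  then have "v \<in> sector n"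
    using w b \<beta> by (auto simp: sector_def v_def norm_mult simp flip: \<beta>_def)
  moreover have "w = sector_rotation n j v"
  proof -
    have "sector_rotation n j v = of_real (norm w) * cis (real j * \<beta> + b)"
      using n by (simp add: sector_rotation_eq v_def \<beta>_def flip: cis_mult)
    also have "\<dots> = w" using Arg2pi_eq[of w] by (simp add: b_def cis_conv_exp)
    finally show ?thesis by simp
  qed
  ultimately show ?thesis using that by blast
qed

lemma elliptic_params_full_eq:
  assumes n: "n \<ge> 2"
  shows "elliptic_params_full n = {w \<in> ball 0 1. \<nexists>\<zeta>. nonrepelling_boundary_fixed_point n w \<zeta>}"
proof -
  have "elliptic_params_full n = {w \<in> ball 0 1. elliptic (blaschke_pow n w)}" (is "_ = ?E")
  proof
    have "norm (sector_rotation n j w) = norm w" for j w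
      using n by (simp add: sector_rotation_eq norm_mult)
    then show "elliptic_params_full n \<subseteq> ?E"
      using n by (auto simp: elliptic_params_full_def elliptic_params_def sector_def elliptic_rotate_iff)
    show "?E \<subseteq> elliptic_params_full n"
    proof
      fix w assume w: "w \<in> ?E"
      then obtain j v where v: "j \<le> n - 2" "v \<in> sector n" "w = sector_rotation n j v"
        using sector_rotation_cover[OF n, of w] by auto
      then have "elliptic (blaschke_pow n v)"
        using w elliptic_rotate_iff[OF n, of v j] by (simp add: sector_def)
      then have vE: "v \<in> elliptic_params n" using v(2) by (simp add: elliptic_params_def)
      show "w \<in> elliptic_params_full n"
      proof (cases "j = 0")
        case True
        then have "w = v" using v(3) n by (simp add: sector_rotation_eq)
        then show ?thesis using vE by (simp add: elliptic_params_full_def)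
      next
        case False
        then have "j \<in> {1..n - 2}" using v(1) by simp
        then show ?thesis using vE v(3) unfolding elliptic_params_full_def by blast
      qed
    qed
  qed
  then show ?thesis using n by (auto simp: elliptic_iff)
qed

section \<open>The domain of elliptic parameters\<close>

lemma norm_ge_if_nonrepelling:
  assumes w: "norm w < 1" and "nonrepelling_boundary_fixed_point n w \<zeta>"
  shows "(real n - 1) / (real n + 1) \<le> norm w"
proof -
  have "norm (\<zeta> - w) \<le> 1 + norm w"
    using assms(2) norm_triangle_ineq4[of \<zeta> w] by (simp add: nonrepelling_boundary_fixed_point_def)
  then have "(norm (\<zeta> - w))\<^sup>2 \<le> (1 + norm w)\<^sup>2" by (intro power_mono) auto
  then have "real n * (1 - (norm w)\<^sup>2) \<le> (1 + norm w)\<^sup>2"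
    using assms(2) unfolding nonrepelling_boundary_fixed_point_def by linarith
  then have "(1 + norm w) * (real n * (1 - norm w)) \<le> (1 + norm w) * (1 + norm w)"
    by (simp add: power2_eq_square algebra_simps)
  then have "real n * (1 - norm w) \<le> 1 + norm w"
    by (rule mult_left_le_imp_le) (simp add: add_pos_nonneg)
  then show ?thesis by (simp add: divide_simps algebra_simps)
qed

theorem theorem1p4:
  fixes n :: nat
  assumes "n \<ge> 2"
  shows "elliptic_params_full n \<subseteq> ball 0 1
    \<and> is_domain (elliptic_params_full n)
    \<and> starlike_about_0 (elliptic_params_full n)
    \<and> {w \<in> ball 0 1. norm w < (real n - 1) / (real n + 1)} \<subseteq> elliptic_params_full n"
proof -
  define E where "E = {w \<in> ball 0 1. \<nexists>\<zeta>. nonrepelling_boundary_fixed_point n w \<zeta>}"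
  have disk: "{w \<in> ball 0 1. norm w < (real n - 1) / (real n + 1)} \<subseteq> E"
    using norm_ge_if_nonrepelling[of _ n] by (force simp: E_def)
  have "(real n - 1) / (real n + 1) > 0" using assms by simp
  then have "0 \<in> E" using disk by auto
  have ray: "of_real t * w \<in> E" if "w \<in> E" "0 \<le> t" "t \<le> 1" for t w
  proof -
    have "norm (of_real t * w) < 1"
      using that mult_left_le_one_le[of "norm w" t] by (simp add: E_def norm_mult)
    then show ?thesis using that nonrepelling_outward[of t w n] by (auto simp: E_def)
  qed
  have "starlike E"
    unfolding starlike_def
  proof (intro bexI[OF _ \<open>0 \<in> E\<close>] ballI subsetI)
    fix w z assume "w \<in> E" "z \<in> closed_segment 0 w"
    then show "z \<in> E" using ray by (auto simp: closed_segment_def scaleR_conv_of_real)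
  qed
  then have "connected E" by (rule starlike_imp_connected)
  moreover have "open E" unfolding E_def by (rule open_no_nonrepelling)
  ultimately have "is_domain E" using \<open>0 \<in> E\<close> by (auto simp: is_domain_def)
  moreover have "starlike_about_0 E" using ray by (simp add: starlike_about_0_def)
  ultimately show ?thesis
    using disk unfolding elliptic_params_full_eq[OF assms] E_def by auto
qed

end
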